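(* Let $G$ be a triangle-free graph of order $10$ with $\chi_1(G)=3$. Then either $G\cong G_5$, or there exists a vertex $u^*$ of $G$ such that $G-u^*\cong G_i$ for some $i$ with $1\le i\le 4$.
   Context: Graphs are finite, undirected, with no loops or multiple edges. The order of a graph is its number of vertices. $\Delta(G)$ is the maximum degree, $G[U]$ is the subgraph induced on $U$, and $G-u^*$ is the graph obtained by deleting the vertex $u^*$. For a nonnegative integer $k$, a set $U\subseteq V(G)$ is $k$-independent if $\Delta(G[U])\le k$. $G$ is $(m,k)$-colourable if $V(G)$ can be partitioned into $m$ (possibly empty) $k$-independent sets. The $k$-defective chromatic number $\chi_k(G)$ is the least positive integer $m$ for which $G$ is $(m,k)$-colourable. The graphs $G_1,\dots,G_5$ are defined as follows ("$X$ is completely joined to $Y$" means every vertex of $X$ is adjacent to every vertex of $Y$; there are no edges other than those listed). $G_1,G_2,G_3$ have the 9 vertices $u,u_1,u_2,u_3,u_4,z_1,z_2,z,z_3$. In each, $u$ is adjacent to $u_1,u_2,u_3,u_4$; $\{u_1,u_2\}$ is completely joined to $\{z_1,z_2\}$; and $\{u_3,u_4\}$ is completely joined to $\{z,z_3\}$. In addition: $G_1$ has the edges $zz_1, zz_2$; $G_2$ has the edges $zz_1,zz_2,z_3z_1$; $G_3$ has the edges $zz_1,zz_2,z_3z_1,z_3z_2$. $G_4$ has the 9 vertices $u,u_1,u_2,u_3,u_4,u_5,z_1,z_2,z$; $u$ is adjacent to $u_1,\dots,u_5$; $\{u_1,u_2\}$ is completely joined to $\{z_1,z_2\}$; $z$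 is adjacent to $u_3,u_4,u_5,z_1,z_2$. $G_5$ has the 10 vertices $u,v,u_1,u_2,u_3,u_4,u_5,z_1,z_2,z$; $\{u,v\}$ is completely joined to $\{u_1,u_2,u_3,u_4,u_5\}$; $z$ is adjacent to $u_1,u_2,z_1,z_2$; $z_1$ is adjacent to $u_3,u_4$; $z_2$ is adjacent to $u_3,u_5$. *)

theory Defs
  imports "Graph_Theory.Digraph_Isomorphism" "Graph_Theory.Pair_Digraph" "HOL-Library.Disjoint_Sets"
begin

text \<open>
  Finite simple graphs are the symmetric digraphs of the locale \<^locale>\<open>graph\<close>: an edge
  is a pair of opposite arcs, so the degree of a vertex is its out-degree, and
  \<^const>\<open>digraph_iso\<close> is isomorphism of simple graphs.
\<close>

definition triangle_free :: "('a, 'b) pre_digraph \<Rightarrow> bool" where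
  "triangle_free G \<longleftrightarrow> \<not> (\<exists>x y z. x \<rightarrow>\<^bsub>G\<^esub> y \<and> y \<rightarrow>\<^bsub>G\<^esub> z \<and> z \<rightarrow>\<^bsub>G\<^esub> x)"

text \<open>The inserted \<open>0\<close> only matters for the graph without vertices.\<close>

definition max_degree :: "('a, 'b) pre_digraph \<Rightarrow> nat" where
  "max_degree G = Max (insert 0 (out_degree G ` verts G))"

definition k_independent :: "('a, 'b) pre_digraph \<Rightarrow> nat \<Rightarrow> 'a set \<Rightarrow> bool" where
  "k_independent G k W \<longleftrightarrow> W \<subseteq> verts G \<and> max_degree (G \<restriction> W) \<le> k"

definition colourable :: "('a, 'b) pre_digraph \<Rightarrow> nat \<Rightarrow> nat \<Rightarrow> bool" where
  "colourable G m k \<longleftrightarrow>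
    (\<exists>P :: nat \<Rightarrow> 'a set. (\<Union>i<m. P i) = verts G \<and> disjoint_family_on P {..<m} \<and>
      (\<forall>i<m. k_independent G k (P i)))"

definition defective_chromatic_number :: "nat \<Rightarrow> ('a, 'b) pre_digraph \<Rightarrow> nat" (\<open>\<chi>\<close>) where
  "\<chi> k G = (LEAST m. 0 < m \<and> colourable G m k)"

datatype vertex = U | V | U1 | U2 | U3 | U4 | U5 | Z1 | Z2 | Z | Z3

text \<open>The simple graph with vertex set \<open>W\<close> and an edge \<open>xy\<close> for each \<open>(x, y) \<in> E\<close>.\<close>

definition undirected :: "'a set \<Rightarrow> 'a rel \<Rightarrow> ('a, 'a \<times> 'a) pre_digraph" where
  "undirected W E = with_proj \<lparr> pverts = W, parcs = E \<union> E\<inverse> \<rparr>"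

text \<open>Complete joins between \<open>X\<close> and \<open>Y\<close> are written as products \<open>X \<times> Y\<close>.\<close>

definition base_edges :: "vertex rel" where
  "base_edges = {U} \<times> {U1, U2, U3, U4} \<union> {U1, U2} \<times> {Z1, Z2} \<union> {U3, U4} \<times> {Z, Z3}"

definition G1 :: "(vertex, vertex \<times> vertex) pre_digraph" where
  "G1 = undirected {U, U1, U2, U3, U4, Z1, Z2, Z, Z3}
    (base_edges \<union> {(Z, Z1), (Z, Z2)})"

definition G2 :: "(vertex, vertex \<times> vertex) pre_digraph" where
  "G2 = undirected {U, U1, U2, U3, U4, Z1, Z2, Z, Z3}
    (base_edges \<union> {(Z, Z1), (Z, Z2), (Z3, Z1)})"

definition G3 :: "(vertex, vertex \<times> vertex) pre_digraph" where
  "G3 = undirected {U, U1, U2, U3, U4, Z1, Z2, Z, Z3}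
    (base_edges \<union> {(Z, Z1), (Z, Z2), (Z3, Z1), (Z3, Z2)})"

definition G4 :: "(vertex, vertex \<times> vertex) pre_digraph" where
  "G4 = undirected {U, U1, U2, U3, U4, U5, Z1, Z2, Z}
    ({U} \<times> {U1, U2, U3, U4, U5} \<union> {U1, U2} \<times> {Z1, Z2} \<union> {Z} \<times> {U3, U4, U5, Z1, Z2})"

definition G5 :: "(vertex, vertex \<times> vertex) pre_digraph" where
  "G5 = undirected {U, V, U1, U2, U3, U4, U5, Z1, Z2, Z}
    ({U, V} \<times> {U1, U2, U3, U4, U5} \<union> {Z} \<times> {U1, U2, Z1, Z2} \<union>
     {Z1} \<times> {U3, U4} \<union> {Z2} \<times> {U3, U5})"

end

theory Submission
  imports Defs
begin

text \<open>
  For every set \<open>S\<close> of vertices, some vertex has two neighbours on its own side of \<open>S\<close>. Choosing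
  \<open>S\<close> with as few monochromatic edges as possible (Lovasz) yields a vertex of degree at least 4,
  so \<open>G\<close> contains the star \<open>K\<^bsub>1,4\<^esub>\<close>. That a star leads to the conclusion is a finite case
  distinction on the adjacency of pairs of vertices. A branch ends when the known non-edges admit
  a partition into two 1-independent sets, or when the known edges and non-edges contain, up to
  renaming the vertices, one of \<open>G\<^sub>1, \<dots>, G\<^sub>5\<close> or a configuration treated before. Renaming, and
  recording for each configuration only the edges and non-edges that its treatment needed, keeps
  the case distinction small enough to be checked by the simplifier.
\<close>

section \<open>Case distinctions and their checker\<close>

text \<open>
  \<open>Colouring A\<close> closes a branch by the 2-colouring with classes \<open>A\<close> and its complement;
  \<open>Refer k xs\<close> closes it by the \<open>k\<close>-th known pattern, whose vertex \<open>i\<close> is renamed to \<open>xs ! i\<close>;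
  \<open>Split a b c d\<close> continues with \<open>c\<close> if \<open>a\<close> and \<open>b\<close> are adjacent, and with \<open>d\<close> otherwise.
\<close>

datatype certificate =
  Colouring "nat list"
| Refer nat "nat list"
| Split nat nat certificate certificate

text \<open>
  A pattern lists edges and non-edges between the vertices \<open>0, \<dots>, 9\<close>. A state stores the same
  information as two families of neighbour lists, closed under: two vertices with a common
  neighbour are not adjacent.
\<close>

type_synonym pattern = "(nat \<times> nat) list \<times> (nat \<times> nat) list"
type_synonym state = "nat list list \<times> nat list list"

definition link :: "nat \<Rightarrow> nat \<Rightarrow> nat list list \<Rightarrow> nat list list" where
  "link a b R = R[a := b # R ! a, b := a # R ! b]"

fun add_nonedge :: "nat \<times> nat \<Rightarrow> state \<Rightarrow> state" where
  "add_nonedge (a, b) (E, N) = (E, link a b N)"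

text \<open>The non-edges forced by triangle-freeness are added at once: known neighbours of
  \<open>b\<close> become non-neighbours of \<open>a\<close>, and known neighbours of
  \<open>a\<close> become non-neighbours of \<open>b\<close>.\<close>

fun add_edge :: "nat \<times> nat \<Rightarrow> state \<Rightarrow> state" where
  "add_edge (a, b) (E, N) = (link a b E, fold (link b) (E ! a) (fold (link a) (E ! b) N))"

definition state_of :: "pattern \<Rightarrow> state" where
  "state_of p = fold add_edge (fst p) (fold add_nonedge (snd p) (replicate 10 [], replicate 10 []))"

text \<open>Pairs not recorded in \<open>N\<close> count as edges, so a class that passes is
  1-independent in every graph compatible with the state.\<close>

definition defect_le_1 :: "nat list list \<Rightarrow> nat list \<Rightarrow> bool" where
  "defect_le_1 N A \<longleftrightarrow>
     list_all (\<lambda>v. length (filter (\<lambda>w. w \<noteq> v \<and> \<not> List.member (N ! v) w) A) \<le> 1) A"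

text \<open>\<open>Refer\<close> reaches only into \<open>L\<close>, the patterns treated before, so
  no argument is circular. Its conditions on \<open>xs\<close> make the renaming a permutation of
  the ten indices.\<close>

fun check :: "pattern list \<Rightarrow> state \<Rightarrow> certificate \<Rightarrow> bool" where
  "check L (E, N) (Colouring A) \<longleftrightarrow>
     defect_le_1 N A \<and> defect_le_1 N (filter (\<lambda>v. \<not> List.member A v) [0..<10])"
| "check L (E, N) (Refer k xs) \<longleftrightarrow>
     k < length L \<and> length xs = 10 \<and> distinct xs \<and> list_all (\<lambda>x. x < 10) xs \<and>
     list_all (\<lambda>(i, j). i < 10 \<and> j < 10 \<and> List.member (E ! (xs ! i)) (xs ! j)) (fst (L ! k)) \<and>
     list_all (\<lambda>(i, j). i < 10 \<and> j < 10 \<and> List.member (N ! (xs ! i)) (xs ! j)) (snd (L ! k))"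
| "check L s (Split a b c d) \<longleftrightarrow>
     a < 10 \<and> b < 10 \<and> check L (add_edge (a, b) s) c \<and> check L (add_nonedge (a, b) s) d"

text \<open>Keeps \<open>nth\<close> and list updates on the ten rows of a state within
  bounds.\<close>

definition in_range :: "pattern \<Rightarrow> bool" where
  "in_range p \<longleftrightarrow> list_all (\<lambda>(i, j). i < 10 \<and> j < 10) (fst p @ snd p)"

text \<open>
  A conditional rather than a conjunction keeps the simplifier from evaluating the remaining
  entries before the first one is settled.
\<close>

fun check_all :: "pattern list \<Rightarrow> (pattern \<times> certificate) list \<Rightarrow> bool" where
  "check_all L [] \<longleftrightarrow> True"
| "check_all L ((p, c) # cs) \<longleftrightarrow>
     (if in_range p \<and> check L (state_of p) c then check_all (L @ [p]) cs else False)"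

text \<open>Every pair \<open>i < j\<close> is listed, as an edge or as a non-edge, so the pattern
  describes an induced subgraph; symmetry and the absence of loops cover the other pairs.\<close>

definition pattern_of :: "'b list \<Rightarrow> ('b, 'b \<times> 'b) pre_digraph \<Rightarrow> pattern" where
  "pattern_of xs H = partition (\<lambda>(i, j). (xs ! i, xs ! j) \<in> arcs H)
     (filter (\<lambda>(i, j). i < j) (List.product [0..<length xs] [0..<length xs]))"

text \<open>The positions are the numbers \<open>0\<close> to \<open>4\<close> used by
  \<open>Refer\<close>. The first four patterns use nine indices and leave index \<open>9\<close>
  for the vertex to be deleted.\<close>

definition targets :: "pattern list" where
  "targets =
    [pattern_of [U, U1, U2, U3, U4, Z1, Z2, Z, Z3] G1,
     pattern_of [U, U1, U2, U3, U4, Z1, Z2, Z, Z3] G2,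
     pattern_of [U, U1, U2, U3, U4, Z1, Z2, Z, Z3] G3,
     pattern_of [U, U1, U2, U3, U4, U5, Z1, Z2, Z] G4,
     pattern_of [U, V, U1, U2, U3, U4, U5, Z1, Z2, Z] G5]"

section \<open>Soundness of the checker\<close>

definition realizes :: "('a, 'b) pre_digraph \<Rightarrow> (nat \<Rightarrow> 'a) \<Rightarrow> pattern \<Rightarrow> bool" where
  "realizes G f p \<longleftrightarrow>
     (\<forall>(i, j) \<in> set (fst p). f i \<rightarrow>\<^bsub>G\<^esub> f j) \<and> (\<forall>(i, j) \<in> set (snd p). \<not> f i \<rightarrow>\<^bsub>G\<^esub> f j)"

text \<open>Without multiple arcs an arc is determined by its ends, so a bijection of the vertices
  that respects adjacency induces the bijection \<open>k\<close> of the arcs.\<close>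

lemma digraph_iso_undirectedI:
  assumes "nomulti_digraph G" and h: "bij_betw h (verts G) W" and E: "E \<subseteq> W \<times> W"
    and adj: "\<And>x y. x \<in> verts G \<Longrightarrow> y \<in> verts G \<Longrightarrow> x \<rightarrow>\<^bsub>G\<^esub> y \<longleftrightarrow> (h x, h y) \<in> E \<union> E\<inverse>"
  shows "digraph_iso G (undirected W E)"
proof -
  interpret nomulti_digraph G by fact
  define k where "k a = (h (tail G a), h (head G a))" for a
  have inj: "inj_on h (verts G)" and im: "h ` verts G = W"
    using h by (auto simp: bij_betw_def)
  have "inj_on k (arcs G)"
  proof (rule inj_onI)
    fix a b assume "a \<in> arcs G" "b \<in> arcs G" "k a = k b"
    then show "a = b"
      by (intro no_multi_arcs) (auto simp: k_def arc_to_ends_def dest: inj_onD[OF inj])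
  qed
  moreover have "k ` arcs G = E \<union> E\<inverse>"
  proof (intro equalityI subsetI)
    fix e assume "e \<in> k ` arcs G"
    then obtain a where "a \<in> arcs G" "e = k a" by blast
    then show "e \<in> E \<union> E\<inverse>"
      using adj[of "tail G a" "head G a"] by (auto simp: k_def in_arcs_imp_in_arcs_ends)
  next
    fix e assume e: "e \<in> E \<union> E\<inverse>"
    then have "fst e \<in> W" "snd e \<in> W" using E by auto
    then obtain x y where xy: "x \<in> verts G" "y \<in> verts G" "e = (h x, h y)"
      using im by (metis imageE prod.collapse)
    then have "x \<rightarrow>\<^bsub>G\<^esub> y" using adj e by simp
    then obtain a where "a \<in> arcs G" "tail G a = x" "head G a = y"
      by (auto simp: arcs_ends_conv)
    then show "e \<in> k ` arcs G" using xy by (auto simp: k_def)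
  qed
  ultimately have
    "digraph_isomorphism \<lparr>iso_verts = h, iso_arcs = k, iso_head = snd, iso_tail = fst\<rparr>"
    "undirected W E = app_iso \<lparr>iso_verts = h, iso_arcs = k, iso_head = snd, iso_tail = fst\<rparr> G"
    using inj im by (auto simp: digraph_isomorphism_def k_def undirected_def with_proj_def app_iso_def
        intro: wf_digraph_axioms)
  then show ?thesis unfolding digraph_iso_def by blast
qed

text \<open>The pattern decides every pair of distinct indices below \<open>n\<close>, and
  \<open>f\<close> reaches every vertex, so adjacency in \<open>G\<close> is known completely.
  Sending \<open>x\<close> to the name \<open>xs ! g x\<close> preserves it; irreflexivity of
  \<open>E\<close> settles the diagonal.\<close>

lemma realizes_pattern_of:
  assumes "graph G" and f: "bij_betw f {..<n} (verts G)" and real: "realizes G f (pattern_of xs H)"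
    and H: "H = undirected (set xs) E" and E: "E \<subseteq> set xs \<times> set xs" "irrefl E"
    and xs: "distinct xs" "length xs = n"
  shows "digraph_iso G H"
proof -
  interpret graph G by fact
  define g where "g = inv_into {..<n} f"
  have g: "bij_betw g (verts G) {..<n}"
    unfolding g_def by (rule bij_betw_inv_into[OF f])
  have fg: "f (g x) = x" if "x \<in> verts G" for x
    using f that unfolding g_def by (metis bij_betw_inv_into_right)
  have h: "bij_betw (\<lambda>x. xs ! g x) (verts G) (set xs)"
    using bij_betw_trans[OF g bij_betw_nth[OF xs(1) _ refl, of "{..<n}"]] xs(2)
    by (simp add: comp_def)
  have arcs: "arcs H = E \<union> E\<inverse>" by (simp add: H undirected_def)
  have adj_less: "f i \<rightarrow>\<^bsub>G\<^esub> f j \<longleftrightarrow> (xs ! i, xs ! j) \<in> E \<union> E\<inverse>" if "i < j" "j < n" for i j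
  proof -
    have "(i, j) \<in> set (fst (pattern_of xs H)) \<longleftrightarrow> (xs ! i, xs ! j) \<in> E \<union> E\<inverse>"
      and "(i, j) \<in> set (snd (pattern_of xs H)) \<longleftrightarrow> (xs ! i, xs ! j) \<notin> E \<union> E\<inverse>"
      using that less_trans[OF that] xs(2) by (auto simp: pattern_of_def arcs)
    then show ?thesis using real unfolding realizes_def by blast
  qed
  have adj: "f i \<rightarrow>\<^bsub>G\<^esub> f j \<longleftrightarrow> (xs ! i, xs ! j) \<in> E \<union> E\<inverse>" if ij: "i < n" "j < n" for i j
  proof (cases i j rule: linorder_cases)
    case less then show ?thesis using adj_less ij by blast
  next
    case equal
    then show ?thesis using E(2) adj_not_same by (auto simp: irrefl_def)
  next
    case greater
    then have "f j \<rightarrow>\<^bsub>G\<^esub> f i \<longleftrightarrow> (xs ! j, xs ! i) \<in> E \<union> E\<inverse>" using adj_less ij by blast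
    then show ?thesis using arcs_ends_symmetric[OF sym_arcs] by auto
  qed
  have "digraph_iso G (undirected (set xs) E)"
  proof (rule digraph_iso_undirectedI[OF nomulti_digraph h E(1)])
    fix x y assume xy: "x \<in> verts G" "y \<in> verts G"
    then have "g x < n" "g y < n" using g by (auto simp: bij_betw_def)
    from adj[OF this] show "x \<rightarrow>\<^bsub>G\<^esub> y \<longleftrightarrow> (xs ! g x, xs ! g y) \<in> E \<union> E\<inverse>"
      using xy by (simp add: fg)
  qed
  then show ?thesis by (simp add: H)
qed

section \<open>States as partial information about a graph\<close>

definition rows_within :: "(nat \<Rightarrow> nat \<Rightarrow> bool) \<Rightarrow> nat list list \<Rightarrow> bool" where
  "rows_within P R \<longleftrightarrow> length R = 10 \<and> (\<forall>a < 10. set (R ! a) \<subseteq> {b. b < 10 \<and> P a b})"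

text \<open>Both families are merely contained in the true relations, so a pair that occurs in
  neither is undecided.\<close>

definition graph_of_state :: "('a, 'b) pre_digraph \<Rightarrow> (nat \<Rightarrow> 'a) \<Rightarrow> state \<Rightarrow> bool" where
  "graph_of_state G f s \<longleftrightarrow> rows_within (\<lambda>a b. f a \<rightarrow>\<^bsub>G\<^esub> f b) (fst s) \<and>
     rows_within (\<lambda>a b. \<not> f a \<rightarrow>\<^bsub>G\<^esub> f b) (snd s)"

lemma rows_within_link:
  assumes "rows_within P R" "a < 10" "b < 10" "P a b" "P b a"
  shows "rows_within P (link a b R)"
  using assms by (auto simp: rows_within_def link_def nth_list_update)

lemma rows_withinD: "rows_within P R \<Longrightarrow> b \<in> set (R ! a) \<Longrightarrow> a < 10 \<Longrightarrow> b < 10 \<and> P a b"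
  unfolding rows_within_def by blast

lemma max_degree_le_iff:
  assumes "finite (verts G)"
  shows "max_degree G \<le> k \<longleftrightarrow> (\<forall>x \<in> verts G. out_degree G x \<le> k)"
  using assms by (simp add: max_degree_def)

text \<open>Order 10 allows the vertices to be indexed by \<open>{..<10}\<close>, triangle-freeness
  justifies the non-edges derived in \<open>add_edge\<close>, and \<open>not_colourable\<close>
  refutes \<open>Colouring\<close> leaves and provides the initial star.\<close>

locale non_two_colourable = graph G for G :: "('a, 'b) pre_digraph" +
  assumes card_verts: "card (verts G) = 10"
    and triangle_free: "triangle_free G"
    and not_colourable: "\<not> colourable G 2 1"
begin

section \<open>Adjacency and the failure of 2-colourings\<close>

lemma adj_sym: "x \<rightarrow>\<^bsub>G\<^esub> y \<longleftrightarrow> y \<rightarrow>\<^bsub>G\<^esub> x"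
  using arcs_ends_symmetric[OF sym_arcs] by blast

text \<open>Two arcs leaving \<open>x\<close> inside \<open>S\<close> have the same head by
  assumption, and hence coincide since there are no multiple arcs.\<close>

lemma k_independent_1I:
  assumes "S \<subseteq> verts G"
    and "\<And>x y z. x \<in> S \<Longrightarrow> y \<in> S \<Longrightarrow> z \<in> S \<Longrightarrow> x \<rightarrow>\<^bsub>G\<^esub> y \<Longrightarrow> x \<rightarrow>\<^bsub>G\<^esub> z \<Longrightarrow> y = z"
  shows "k_independent G 1 S"
proof -
  have "out_degree (G \<restriction> S) x \<le> 1" if x: "x \<in> S" for x
  proof -
    have "a = b" if "a \<in> out_arcs (G \<restriction> S) x" "b \<in> out_arcs (G \<restriction> S) x" for a b
    proof (rule no_multi_arcs)
      have ab: "a \<in> arcs G" "b \<in> arcs G" "tail G a = x" "tail G b = x" "head G a \<in> S" "head G b \<in> S"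
        using that by auto
      then have "x \<rightarrow>\<^bsub>G\<^esub> head G a" "x \<rightarrow>\<^bsub>G\<^esub> head G b"
        using in_arcs_imp_in_arcs_ends by force+
      then have "head G a = head G b" using assms(2) x ab by blast
      then show "arc_to_ends G a = arc_to_ends G b" using ab by (simp add: arc_to_ends_def)
    qed (use that in auto)
    moreover have "finite (out_arcs (G \<restriction> S) x)"
      by (rule finite_subset[OF _ finite_arcs]) auto
    ultimately show ?thesis
      unfolding out_degree_def One_nat_def by (metis card_le_Suc0_iff_eq)
  qed
  then show ?thesis
    using assms(1) finite_subset[OF assms(1)] by (simp add: k_independent_def max_degree_le_iff)
qed

text \<open>If the parts of \<open>verts G\<close> inside and outside \<open>S\<close> were both
  1-independent, they would form a forbidden 2-colouring. In this form \<open>not_colourable\<close>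
  enters both the soundness of \<open>Colouring\<close> and the search for a vertex of large
  degree.\<close>

lemma monochromatic_path:
  obtains x y z where "x \<in> verts G" "x \<rightarrow>\<^bsub>G\<^esub> y" "x \<rightarrow>\<^bsub>G\<^esub> z" "y \<noteq> z"
    "x \<in> S \<longleftrightarrow> y \<in> S" "x \<in> S \<longleftrightarrow> z \<in> S"
proof -
  define P where "P i = (if i = 0 then verts G \<inter> S else verts G - S)" for i :: nat
  have "\<not> (\<forall>i<2. k_independent G 1 (P i))"
  proof
    assume *: "\<forall>i<2. k_independent G 1 (P i)"
    have "{..<2} = {0, 1::nat}" by auto
    then have "(\<Union>i<2. P i) = verts G" "disjoint_family_on P {..<2}"
      by (auto simp: P_def disjoint_family_on_def)
    then show False using * not_colourable unfolding colourable_def by blast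
  qed
  then obtain i where i: "i < 2" "\<not> k_independent G 1 (P i)" by blast
  moreover have "P i \<subseteq> verts G" by (auto simp: P_def)
  ultimately obtain x y z where "x \<in> P i" "y \<in> P i" "z \<in> P i" "x \<rightarrow>\<^bsub>G\<^esub> y" "x \<rightarrow>\<^bsub>G\<^esub> z" "y \<noteq> z"
    using k_independent_1I by blast
  then show thesis using that[of x y z] by (auto simp: P_def split: if_splits)
qed

text \<open>The conclusion of the theorem, which every branch of the case distinction must
  reach.\<close>

definition settled :: bool where
  "settled \<longleftrightarrow> digraph_iso G G5 \<or>
    (\<exists>u \<in> verts G. \<exists>H \<in> {G1, G2, G3, G4}. digraph_iso (pre_digraph.del_vert G u) H)"

text \<open>Quantifying over all bijections lets \<open>Refer\<close> apply a treated pattern under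
  any renaming.\<close>

definition conclusive :: "pattern \<Rightarrow> bool" where
  "conclusive p \<longleftrightarrow> (\<forall>f. bij_betw f {..<10} (verts G) \<longrightarrow> realizes G f p \<longrightarrow> settled)"

section \<open>Updates keep a state true of the graph\<close>

lemma graph_of_state_add_nonedge:
  assumes "graph_of_state G f s" "a < 10" "b < 10" "\<not> f a \<rightarrow>\<^bsub>G\<^esub> f b"
  shows "graph_of_state G f (add_nonedge (a, b) s)"
proof -
  have "\<not> f b \<rightarrow>\<^bsub>G\<^esub> f a" using assms(4) adj_sym by blast
  then show ?thesis
    using assms by (cases s) (simp add: graph_of_state_def rows_within_link)
qed

lemma graph_of_state_fold_link:
  assumes "graph_of_state G f (E, N)" "a < 10" "\<And>b. b \<in> set bs \<Longrightarrow> b < 10 \<and> \<not> f a \<rightarrow>\<^bsub>G\<^esub> f b"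
  shows "graph_of_state G f (E, fold (link a) bs N)"
  using assms
proof (induction bs arbitrary: N)
  case (Cons b bs)
  have "graph_of_state G f (E, link a b N)"
    using graph_of_state_add_nonedge[of f "(E, N)" a b] Cons.prems(1,2) Cons.prems(3)[of b] by simp
  then show ?case using Cons.IH Cons.prems(2,3) by simp
qed simp

text \<open>A neighbour of one end of the edge \<open>f a\<close>, \<open>f b\<close> that was
  adjacent to the other end would complete a triangle, so both folds record only true
  non-edges.\<close>

lemma graph_of_state_add_edge:
  assumes s: "graph_of_state G f s" and ab: "a < 10" "b < 10" "f a \<rightarrow>\<^bsub>G\<^esub> f b"
  shows "graph_of_state G f (add_edge (a, b) s)"
proof -
  obtain E N where [simp]: "s = (E, N)" by (cases s)
  have ba: "f b \<rightarrow>\<^bsub>G\<^esub> f a" using ab(3) adj_sym by blast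
  have no_tri: "\<not> x \<rightarrow>\<^bsub>G\<^esub> z" if "x \<rightarrow>\<^bsub>G\<^esub> y" "y \<rightarrow>\<^bsub>G\<^esub> z" for x y z
    using triangle_free that adj_sym unfolding triangle_free_def by blast
  have E: "c < 10 \<and> f i \<rightarrow>\<^bsub>G\<^esub> f c" if "c \<in> set (E ! i)" "i < 10" for c i
    using s rows_withinD that by (fastforce simp: graph_of_state_def)
  have "graph_of_state G f (E, fold (link b) (E ! a) (fold (link a) (E ! b) N))"
    using s ab E no_tri[OF ab(3)] no_tri[OF ba] by (intro graph_of_state_fold_link) auto
  then show ?thesis
    using ab ba by (simp add: graph_of_state_def rows_within_link)
qed

lemma graph_of_state_state_of:
  assumes "realizes G f p" "\<forall>(i, j) \<in> set (fst p) \<union> set (snd p). i < 10 \<and> j < 10"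
  shows "graph_of_state G f (state_of p)"
proof -
  have edges: "graph_of_state G f (fold add_edge es s)"
    if "\<And>i j. (i, j) \<in> set es \<Longrightarrow> i < 10 \<and> j < 10 \<and> f i \<rightarrow>\<^bsub>G\<^esub> f j" "graph_of_state G f s" for es s
    using that
  proof (induction es arbitrary: s)
    case (Cons e es)
    have "graph_of_state G f (add_edge e s)"
      using graph_of_state_add_edge[OF Cons.prems(2)] Cons.prems(1) by (cases e) auto
    then have "graph_of_state G f (fold add_edge es (add_edge e s))"
      using Cons.IH Cons.prems(1) by (meson list.set_intros(2))
    then show ?case by simp
  qed simp
  have nonedges: "graph_of_state G f (fold add_nonedge es s)"
    if "\<And>i j. (i, j) \<in> set es \<Longrightarrow> i < 10 \<and> j < 10 \<and> \<not> f i \<rightarrow>\<^bsub>G\<^esub> f j" "graph_of_state G f s" for es s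
    using that
  proof (induction es arbitrary: s)
    case (Cons e es)
    have "graph_of_state G f (add_nonedge e s)"
      using graph_of_state_add_nonedge[OF Cons.prems(2)] Cons.prems(1) by (cases e) auto
    then have "graph_of_state G f (fold add_nonedge es (add_nonedge e s))"
      using Cons.IH Cons.prems(1) by (meson list.set_intros(2))
    then show ?case by simp
  qed simp
  have "graph_of_state G f (replicate 10 [], replicate 10 [])"
    by (simp add: graph_of_state_def rows_within_def)
  then have "graph_of_state G f (fold add_nonedge (snd p) (replicate 10 [], replicate 10 []))"
    using assms by (intro nonedges) (auto simp: realizes_def)
  then show ?thesis
    unfolding state_of_def using assms by (intro edges) (auto simp: realizes_def)
qed

section \<open>Soundness of colourings, references and splits\<close>

lemma defect_le_1D:
  assumes "defect_le_1 N C" "{i, j, k} \<subseteq> set C" "i \<noteq> j" "i \<noteq> k" "j \<notin> set (N ! i)" "k \<notin> set (N ! i)"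
  shows "j = k"
proof -
  \<comment> \<open>\<open>?F\<close> lists the members of \<open>C\<close> that may be neighbours
    of \<open>i\<close>. Both \<open>j\<close> and \<open>k\<close> occur in it, and a list of
    length at most 1 has at most one element.\<close>
  let ?F = "filter (\<lambda>w. w \<noteq> i \<and> \<not> List.member (N ! i) w) C"
  have "length ?F \<le> Suc 0"
    using assms(1,2) unfolding defect_le_1_def list_all_iff One_nat_def by blast
  then have "card (set ?F) \<le> Suc 0"
    using card_length[of ?F] by linarith
  then have "\<forall>v \<in> set ?F. \<forall>w \<in> set ?F. v = w"
    by (simp only: card_le_Suc0_iff_eq[OF List.finite_set])
  then show ?thesis using assms by auto
qed

lemma graph_of_state_edge:
  "graph_of_state G f (E, N) \<Longrightarrow> j \<in> set (E ! i) \<Longrightarrow> i < 10 \<Longrightarrow> f i \<rightarrow>\<^bsub>G\<^esub> f j"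
  unfolding graph_of_state_def using rows_withinD by fastforce

lemma graph_of_state_nonedge:
  "graph_of_state G f (E, N) \<Longrightarrow> j \<in> set (N ! i) \<Longrightarrow> i < 10 \<Longrightarrow> \<not> f i \<rightarrow>\<^bsub>G\<^esub> f j"
  unfolding graph_of_state_def using rows_withinD by fastforce

text \<open>Induction on the certificate: a \<open>Colouring\<close> leaf contradicts
  non-colourability, a \<open>Refer\<close> leaf composes \<open>f\<close> with the renaming, and at
  a \<open>Split\<close> the graph itself decides which branch applies.\<close>

lemma check_sound:
  assumes "check L s c" "\<forall>p \<in> set L. conclusive p"
    and f: "bij_betw f {..<10} (verts G)" and s: "graph_of_state G f s"
  shows settled
  using assms(1) s
proof (induction c arbitrary: s)
  case (Colouring A)
  obtain E N where [simp]: "s = (E, N)" by (cases s)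
  define B where "B = filter (\<lambda>v. \<not> List.member A v) [0..<10]"
  \<comment> \<open>The checker puts no bound on the entries of \<open>A\<close>; the intersection
    discards those that are not indices.\<close>
  define S where "S = f ` (set A \<inter> {..<10})"
  obtain x y z where xyz: "x \<in> verts G" "x \<rightarrow>\<^bsub>G\<^esub> y" "x \<rightarrow>\<^bsub>G\<^esub> z" "y \<noteq> z"
      "x \<in> S \<longleftrightarrow> y \<in> S" "x \<in> S \<longleftrightarrow> z \<in> S"
    by (rule monochromatic_path)
  have "v \<in> f ` {..<10}" if "v \<in> verts G" for v
    using f that by (simp add: bij_betw_def)
  moreover have "y \<in> verts G" "z \<in> verts G" using xyz(2,3) adj_in_verts by blast+
  ultimately obtain i j k where ijk: "i < 10" "j < 10" "k < 10" "x = f i" "y = f j" "z = f k"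
    using xyz(1) by (meson imageE lessThan_iff)
  have S: "f v \<in> S \<longleftrightarrow> v \<in> set A" if "v < 10" for v
    using f that by (auto simp: S_def bij_betw_def dest: inj_onD)
  have "{i, j, k} \<subseteq> set A \<or> {i, j, k} \<subseteq> set B"
    using xyz(5,6) ijk by (simp add: S B_def)
  moreover have "defect_le_1 N A" "defect_le_1 N B"
    using Colouring.prems by (auto simp: B_def)
  moreover have "i \<noteq> j" "i \<noteq> k"
    using xyz ijk adj_not_same by auto
  moreover have "j \<notin> set (N ! i)" "k \<notin> set (N ! i)"
    using xyz(2,3) ijk Colouring.prems(2) graph_of_state_nonedge[of f E N _ i] by auto
  \<comment> \<open>The neighbours \<open>y\<close> and \<open>z\<close> of \<open>x\<close> lie in
    its own class and their indices are not recorded as non-neighbours, so the defect bound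
    identifies them, against \<open>y \<noteq> z\<close>.\<close>
  ultimately have "j = k" using defect_le_1D[of N A i j k] defect_le_1D[of N B i j k] by argo
  then show ?case using xyz ijk by simp
next
  case (Refer k xs)
  obtain E N where [simp]: "s = (E, N)" by (cases s)
  have xs: "distinct xs" "length xs = 10" "set xs \<subseteq> {..<10}"
    using Refer.prems by (auto simp: list_all_iff)
  \<comment> \<open>Ten distinct values below 10 exhaust the indices, so the renaming is a
    permutation.\<close>
  then have "set xs = {..<10}"
    by (intro card_subset_eq) (auto simp: distinct_card)
  then have bij: "bij_betw (\<lambda>i. f (xs ! i)) {..<10} (verts G)"
    using bij_betw_trans[OF bij_betw_nth[OF xs(1) _ refl, of "{..<10}"], of f "verts G"] f xs(2)
    by (simp add: comp_def)
  have xs_less: "xs ! i < 10" if "i < 10" for i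
    using xs that nth_mem[of i xs] by (metis lessThan_iff subsetD)
  have real: "realizes G (\<lambda>i. f (xs ! i)) (L ! k)"
    unfolding realizes_def
    using Refer.prems graph_of_state_edge[of f E N] graph_of_state_nonedge[of f E N] xs_less
    by (auto simp: list_all_iff)
  have "conclusive (L ! k)"
    using Refer.prems(1) assms(2) by simp
  then show ?case using bij real unfolding conclusive_def by blast
next
  case (Split a b c d)
  show ?case
  proof (cases "f a \<rightarrow>\<^bsub>G\<^esub> f b")
    case True
    then show ?thesis using Split graph_of_state_add_edge by (cases s) auto
  next
    case False
    then show ?thesis using Split graph_of_state_add_nonedge by (cases s) auto
  qed
qed

text \<open>An accepted pattern is conclusive by \<open>check_sound\<close> and joins
  \<open>L\<close>, so the later entries may refer to it.\<close>

lemma check_all_sound: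
  assumes "check_all L cs" "\<forall>p \<in> set L. conclusive p"
  shows "\<forall>p \<in> fst ` set cs. conclusive p"
  using assms
proof (induction L cs rule: check_all.induct)
  case (2 L p c cs)
  have "conclusive p"
    unfolding conclusive_def
  proof (intro allI impI)
    fix f assume f: "bij_betw f {..<10} (verts G)" "realizes G f p"
    then have "graph_of_state G f (state_of p)"
      using 2 by (intro graph_of_state_state_of) (auto simp: in_range_def list_all_iff split: if_splits)
    then show settled
      using 2 f by (intro check_sound[of L "state_of p" c f]) (auto split: if_splits)
  qed
  then show ?case using 2 by (auto split: if_splits)
qed simp

section \<open>Deleting a vertex and the five target graphs\<close>

lemma graph_del_vert: "graph (del_vert u)"
proof -
  interpret H: fin_digraph "del_vert u" by (rule fin_digraph_del_vert)
  show ?thesis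
  proof
    show "symmetric (del_vert u)"
      using sym_arcs by (fastforce simp: symmetric_conv del_vert_simps)
  qed (auto simp: del_vert_simps ends_del_vert no_loops no_multi_arcs)
qed

lemma adj_del_vert:
  assumes "x \<noteq> u" "y \<noteq> u"
  shows "x \<rightarrow>\<^bsub>del_vert u\<^esub> y \<longleftrightarrow> x \<rightarrow>\<^bsub>G\<^esub> y"
  using assms by (force simp: arcs_ends_conv del_vert_simps)

text \<open>Index \<open>9\<close> does not occur in the pattern, so \<open>f 9\<close> serves as
  the deleted vertex and \<open>f\<close> on \<open>{..<9}\<close> enumerates the rest, where the
  deletion leaves adjacency unchanged.\<close>

lemma conclusive_pattern_of_9:
  assumes H: "H \<in> {G1, G2, G3, G4}" "H = undirected (set xs) E"
    and E: "E \<subseteq> set xs \<times> set xs" "irrefl E" and xs: "distinct xs" "length xs = 9"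
  shows "conclusive (pattern_of xs H)"
  unfolding conclusive_def
proof (intro allI impI)
  fix f assume f: "bij_betw f {..<10} (verts G)" and real: "realizes G f (pattern_of xs H)"
  have "f ` ({..<10} - {9}) = verts G - {f 9}"
    using f inj_on_image_set_diff[of f "{..<10}" "{..<10}" "{9}"] by (simp add: bij_betw_def)
  moreover have "{..<10} - {9} = {..<9::nat}" by auto
  ultimately have f9: "bij_betw f {..<9} (verts G - {f 9})"
    using f by (auto simp: bij_betw_def intro: inj_on_subset)
  then have "f i \<noteq> f 9" if "i < 9" for i
    using that by (auto simp: bij_betw_def)
  then have "f i \<rightarrow>\<^bsub>del_vert (f 9)\<^esub> f j \<longleftrightarrow> f i \<rightarrow>\<^bsub>G\<^esub> f j" if "i < 9" "j < 9" for i j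
    using that by (intro adj_del_vert) auto
  then have "realizes (del_vert (f 9)) f (pattern_of xs H)"
    using real xs(2) unfolding realizes_def pattern_of_def by fastforce
  then have "digraph_iso (del_vert (f 9)) H"
    using realizes_pattern_of[OF graph_del_vert _ _ H(2) E xs] f9 by (simp add: del_vert_simps)
  moreover have "f 9 \<in> verts G" using f by (auto simp: bij_betw_def)
  ultimately show settled using H(1) unfolding settled_def by blast
qed

lemma conclusive_pattern_of_G5: "conclusive (pattern_of [U, V, U1, U2, U3, U4, U5, Z1, Z2, Z] G5)"
  unfolding conclusive_def
proof (intro allI impI)
  fix f assume "bij_betw f {..<10} (verts G)"
    and "realizes G f (pattern_of [U, V, U1, U2, U3, U4, U5, Z1, Z2, Z] G5)"
  then have "digraph_iso G G5"
    by (rule realizes_pattern_of[OF graph_axioms, where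
          E = "{U, V} \<times> {U1, U2, U3, U4, U5} \<union> {Z} \<times> {U1, U2, Z1, Z2} \<union>
            {Z1} \<times> {U3, U4} \<union> {Z2} \<times> {U3, U5}"])
      (simp_all add: G5_def irrefl_def)
  then show settled by (simp add: settled_def)
qed

lemma conclusive_targets: "\<forall>p \<in> set targets. conclusive p"
proof -
  have "conclusive (pattern_of [U, U1, U2, U3, U4, Z1, Z2, Z, Z3] G1)"
    by (rule conclusive_pattern_of_9[where E = "base_edges \<union> {(Z, Z1), (Z, Z2)}"])
      (simp_all add: G1_def base_edges_def irrefl_def)
  moreover have "conclusive (pattern_of [U, U1, U2, U3, U4, Z1, Z2, Z, Z3] G2)"
    by (rule conclusive_pattern_of_9[where E = "base_edges \<union> {(Z, Z1), (Z, Z2), (Z3, Z1)}"])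
      (simp_all add: G2_def base_edges_def irrefl_def)
  moreover have "conclusive (pattern_of [U, U1, U2, U3, U4, Z1, Z2, Z, Z3] G3)"
    by (rule conclusive_pattern_of_9[where E = "base_edges \<union> {(Z, Z1), (Z, Z2), (Z3, Z1), (Z3, Z2)}"])
      (simp_all add: G3_def base_edges_def irrefl_def)
  moreover have "conclusive (pattern_of [U, U1, U2, U3, U4, U5, Z1, Z2, Z] G4)"
    by (rule conclusive_pattern_of_9[where E = "{U} \<times> {U1, U2, U3, U4, U5} \<union> {U1, U2} \<times> {Z1, Z2} \<union>
          {Z} \<times> {U3, U4, U5, Z1, Z2}"])
      (simp_all add: G4_def irrefl_def)
  ultimately show ?thesis
    using conclusive_pattern_of_G5 by (simp add: targets_def)
qed

section \<open>A vertex of degree at least 4\<close>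

text \<open>
  Moving a bad vertex of degree at most 3 to the other side of \<open>S\<close> decreases the number of
  monochromatic edges.
\<close>

lemma obtains_vertex_of_degree_4:
  obtains x where "x \<in> verts G" "4 \<le> card {y. x \<rightarrow>\<^bsub>G\<^esub> y}"
proof (rule ccontr)
  assume "\<not> thesis"
  then have deg: "x \<in> verts G \<Longrightarrow> card {y. x \<rightarrow>\<^bsub>G\<^esub> y} \<le> 3" for x
    using that[of x] by fastforce
  \<comment> \<open>Ordered pairs are collected, so each monochromatic edge counts twice.\<close>
  define I where "I S = {(x, y). x \<rightarrow>\<^bsub>G\<^esub> y \<and> (x \<in> S \<longleftrightarrow> y \<in> S)}" for S
  have fin: "finite {(x, y). x \<rightarrow>\<^bsub>G\<^esub> y}"
    by (rule finite_subset[of _ "verts G \<times> verts G"]) (auto dest: adj_in_verts)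
  obtain S where S: "\<And>T. card (I S) \<le> card (I T)"
    using ex_has_least_nat[where P = "\<lambda>_. True" and m = "\<lambda>S. card (I S)"] by blast
  obtain x y z where xyz: "x \<in> verts G" "x \<rightarrow>\<^bsub>G\<^esub> y" "x \<rightarrow>\<^bsub>G\<^esub> z" "y \<noteq> z"
      "x \<in> S \<longleftrightarrow> y \<in> S" "x \<in> S \<longleftrightarrow> z \<in> S"
    by (rule monochromatic_path)
  \<comment> \<open>\<open>T\<close> moves \<open>x\<close> to the other side. The pairs in
    \<open>R\<close> avoid \<open>x\<close> and stay monochromatic; at \<open>x\<close>, the edges
    to \<open>A\<close> are monochromatic before the move and those to \<open>B\<close> after
    it.\<close>
  define T where "T = (if x \<in> S then S - {x} else insert x S)"
  define R where "R = {(v, w) \<in> I S. v \<noteq> x \<and> w \<noteq> x}"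
  define A where "A = {w. x \<rightarrow>\<^bsub>G\<^esub> w \<and> (x \<in> S \<longleftrightarrow> w \<in> S)}"
  define B where "B = {w. x \<rightarrow>\<^bsub>G\<^esub> w \<and> (x \<in> S \<longleftrightarrow> w \<notin> S)}"
  have N: "A \<union> B = {y. x \<rightarrow>\<^bsub>G\<^esub> y}" "A \<inter> B = {}" by (auto simp: A_def B_def)
  have "finite {y. x \<rightarrow>\<^bsub>G\<^esub> y}"
    by (rule finite_subset[of _ "verts G"]) (auto dest: adj_in_verts)
  then have finAB: "finite A" "finite B" using N by (metis finite_Un)+
  have "x \<notin> A" "x \<notin> B" using adj_not_same by (auto simp: A_def B_def)
  have count: "card (R \<union> ({x} \<times> C \<union> C \<times> {x})) = card R + 2 * card C" if "finite C" "x \<notin> C" for C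
  proof -
    have "finite R" by (rule finite_subset[OF _ fin]) (auto simp: R_def I_def)
    then have "card (R \<union> ({x} \<times> C \<union> C \<times> {x})) = card R + card ({x} \<times> C \<union> C \<times> {x})"
      using that by (intro card_Un_disjoint) (auto simp: R_def)
    also have "card ({x} \<times> C \<union> C \<times> {x}) = card ({x} \<times> C) + card (C \<times> {x})"
      using that by (intro card_Un_disjoint) auto
    finally show ?thesis by (simp add: card_cartesian_product)
  qed
  have x_adj: "w \<rightarrow>\<^bsub>G\<^esub> x \<longleftrightarrow> x \<rightarrow>\<^bsub>G\<^esub> w" "\<not> x \<rightarrow>\<^bsub>G\<^esub> x" for w
    using adj_sym adj_not_same by blast+
  have "(v, w) \<in> I S \<longleftrightarrow> (v, w) \<in> R \<union> ({x} \<times> A \<union> A \<times> {x})" for v w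
    using x_adj(1)[of v] x_adj(2) by (cases "v = x"; cases "w = x") (auto simp: I_def R_def A_def)
  then have IS: "I S = R \<union> ({x} \<times> A \<union> A \<times> {x})"
    by (simp add: set_eq_iff split_paired_all)
  have T: "v \<in> T \<longleftrightarrow> (v \<in> S) \<noteq> (v = x)" for v
    by (auto simp: T_def)
  have "(v, w) \<in> I T \<longleftrightarrow> (v, w) \<in> R \<union> ({x} \<times> B \<union> B \<times> {x})" for v w
    using x_adj(1)[of v] x_adj(2)
    by (cases "v = x"; cases "w = x") (auto simp: I_def R_def B_def T)
  then have IT: "I T = R \<union> ({x} \<times> B \<union> B \<times> {x})"
    by (simp add: set_eq_iff split_paired_all)
  \<comment> \<open>Minimality gives \<open>card A \<le> card B\<close>. As \<open>y\<close> and
    \<open>z\<close> lie in \<open>A\<close>, the degree of \<open>x\<close> would be at least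
    4.\<close>
  have "card R + 2 * card A \<le> card R + 2 * card B"
    using S[of T] count finAB \<open>x \<notin> A\<close> \<open>x \<notin> B\<close> by (simp add: IS IT)
  moreover have "card A + card B \<le> 3"
    using deg[OF xyz(1)] card_Un_disjoint[OF finAB N(2)] N(1) by simp
  moreover have "2 \<le> card A"
    using card_mono[OF finAB(1), of "{y, z}"] xyz by (simp add: A_def)
  ultimately show False by linarith
qed

lemma settled_if_star_conclusive:
  assumes "conclusive ([(0, 1), (0, 2), (0, 3), (0, 4)], [])"
  shows settled
proof -
  obtain x where x: "x \<in> verts G" "4 \<le> card {y. x \<rightarrow>\<^bsub>G\<^esub> y}"
    by (rule obtains_vertex_of_degree_4)
  obtain T where T: "T \<subseteq> {y. x \<rightarrow>\<^bsub>G\<^esub> y}" "card T = 4" "finite T"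
    by (rule obtain_subset_with_card_n[OF x(2)])
  then obtain ts where ts: "set ts = T" "distinct ts" "length ts = 4"
    by (metis finite_distinct_list distinct_card)
  obtain rs where rs: "set rs = verts G - insert x T" "distinct rs"
    using finite_distinct_list[of "verts G - insert x T"] by auto
  \<comment> \<open>The centre comes first and its four chosen neighbours next, so that the indices
    \<open>0\<close> to \<open>4\<close> realize the star.\<close>
  define xs where "xs = x # ts @ rs"
  have "x \<notin> T" using T adj_not_same by auto
  moreover have "T \<subseteq> verts G" using T by (auto dest: adj_in_verts)
  ultimately have xs: "distinct xs" "set xs = verts G"
    using ts rs x by (auto simp: xs_def)
  then have "length xs = 10" using card_verts distinct_card by metis
  then have "bij_betw (nth xs) {..<10} (verts G)"
    using bij_betw_nth xs by metis
  moreover have "x \<rightarrow>\<^bsub>G\<^esub> ts ! i" if "i < 4" for i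
    using T ts nth_mem[of i ts] that by auto
  then have "realizes G (nth xs) ([(0, 1), (0, 2), (0, 3), (0, 4)], [])"
    using ts(3) by (auto simp: realizes_def xs_def nth_append nth_Cons')
  ultimately show ?thesis using assms unfolding conclusive_def by blast
qed

end

section \<open>The case distinction for stars\<close>

text \<open>
  Found by computer search. The entries are numbered from 5, after the five \<^const>\<open>targets\<close>; the
  stars \<open>K\<^bsub>1,7\<^esub>, K\<^bsub>1,6\<^esub>, K\<^bsub>1,5\<^esub>, K\<^bsub>1,4\<^esub>\<close> occur among them in this order.
\<close>

definition stars_certificate :: "(pattern \<times> certificate) list" where
  "stars_certificate = [
    (([(0,1), (0,2), (0,3), (0,4), (0,5), (0,6), (0,7)], []),
     Split 0 8 (Colouring [1,2,3,4,5,6,7,8]) (Split 0 9 (Colouring [0,8]) (Colouring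
     [1,2,3,4,5,6,7]))),
    (([(0,1), (0,2), (0,3), (0,4), (0,5), (0,6), (1,7), (4,8), (5,7), (5,9), (6,8), (7,8)], []),
     Split 2 8 (Split 8 9 (Split 1 9 (Refer 3 [0,1,5,2,4,6,7,9,8,3]) (Split 3 9 (Split 3 7 (Refer
     3 [0,3,5,2,4,6,7,9,8,1]) (Colouring [0,3,7,8])) (Colouring [0,7,8]))) (Colouring
     [1,2,3,4,5,6])) (Split 8 9 (Split 3 8 (Split 1 9 (Refer 3 [0,1,5,3,4,6,7,9,8,2]) (Split 2 9
     (Split 2 7 (Refer 3 [0,2,5,3,4,6,7,9,8,1]) (Colouring [2,3,4,5,6,7])) (Colouring [0,7,8])))
     (Colouring [1,2,3,4,5,8])) (Colouring [1,2,3,4,5,6]))),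
    (([(0,1), (0,2), (0,3), (0,4), (0,5), (0,6), (1,7), (4,8), (5,7), (5,9), (7,8)], []),
     Split 4 9 (Colouring [1,2,3,4,5,6]) (Split 6 8 (Refer 6 [0,1,2,3,4,5,6,7,8,9]) (Split 2 8
     (Refer 6 [0,1,3,6,2,5,4,7,8,9]) (Colouring [1,2,3,5,6,8])))),
    (([(0,1), (0,2), (0,3), (0,4), (0,5), (0,6), (4,8), (5,7), (5,9), (7,8)], []),
     Split 1 7 (Refer 7 [0,1,2,3,4,5,6,7,8,9]) (Split 2 7 (Refer 7 [0,2,1,3,4,5,6,7,8,9]) (Split
     3 7 (Refer 7 [0,3,1,2,4,5,6,7,8,9]) (Split 6 7 (Refer 7 [0,6,1,2,4,5,3,7,8,9]) (Colouring
     [1,2,3,4,5,6,7]))))),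
    (([(0,1), (0,2), (0,3), (0,4), (0,5), (0,6), (4,8), (7,8), (8,9)], [(0,7), (0,9), (1,8),
    (5,8), (5,9), (6,7), (6,9)]),
     Split 2 9 (Split 3 9 (Colouring [1,2,3,5,6,8]) (Split 3 7 (Colouring [1,2,3,5,6,8]) (Split 1
     7 (Split 3 8 (Split 1 9 (Refer 8 [0,2,4,5,3,1,6,7,8,9]) (Colouring [0,7,8])) (Colouring
     [1,2,3,4,5,8])) (Colouring [1,2,3,4,6,7])))) (Split 3 9 (Split 2 7 (Colouring [1,2,3,5,6,8])
     (Split 3 7 (Refer 8 [0,1,2,5,4,3,6,7,8,9]) (Colouring [1,2,3,4,6,7]))) (Colouring [0,7,8]))),
    (([(0,1), (0,2), (0,3), (0,4), (0,5), (0,6), (4,8), (7,8), (8,9)], [(0,7), (0,9), (5,8),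
    (5,9)]),
     Split 1 8 (Split 3 9 (Split 3 7 (Refer 8 [0,2,4,5,1,3,6,7,8,9]) (Split 6 8 (Colouring
     [0,3,7,8]) (Split 2 8 (Colouring [0,3,7,8]) (Colouring [1,2,3,5,6,8])))) (Split 2 8
     (Colouring [0,7,8]) (Split 2 9 (Split 2 7 (Refer 8 [0,3,4,5,1,2,6,7,8,9]) (Colouring
     [0,2,7,8])) (Colouring [0,7,8])))) (Split 6 8 (Refer 9 [0,1,2,3,4,5,6,7,8,9]) (Split 2 8
     (Refer 9 [0,1,3,6,2,5,4,7,8,9]) (Colouring [1,2,3,5,6,8])))),
    (([(0,1), (0,2), (0,3), (0,4), (0,5), (0,6), (4,8), (5,7), (7,8)], [(0,9)]),
     Split 5 9 (Refer 8 [0,1,2,3,4,5,6,7,8,9]) (Split 8 9 (Refer 10 [0,1,2,3,4,5,6,7,8,9]) (Split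
     4 9 (Refer 8 [0,1,2,3,5,4,6,8,7,9]) (Split 7 9 (Refer 10 [0,1,2,3,5,4,6,8,7,9]) (Colouring
     [1,2,3,4,5,6]))))),
    (([(0,1), (0,2), (0,3), (0,4), (0,5), (0,6), (4,8), (7,8)], [(0,9)]),
     Split 5 7 (Refer 11 [0,1,2,3,4,5,6,7,8,9]) (Split 6 7 (Refer 11 [0,1,2,3,4,6,5,7,8,9])
     (Split 1 7 (Refer 11 [0,2,3,5,1,4,6,8,7,9]) (Split 3 7 (Refer 11 [0,1,2,5,3,4,6,8,7,9])
     (Colouring [1,2,3,4,5,6,7]))))),
    (([(0,1), (0,2), (0,3), (0,4), (0,5), (0,6), (7,8)], [(0,7), (0,9)]),
     Split 4 8 (Refer 12 [0,1,2,3,4,5,6,7,8,9]) (Split 6 8 (Refer 12 [0,1,2,3,6,4,5,7,8,9])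
     (Split 2 8 (Refer 12 [0,1,3,4,2,5,6,7,8,9]) (Split 1 8 (Refer 12 [0,2,3,4,1,5,6,7,8,9])
     (Split 5 8 (Refer 12 [0,1,2,3,5,4,6,7,8,9]) (Colouring [1,2,3,4,5,6,8])))))),
    (([(0,1), (0,2), (0,3), (0,4), (0,5), (0,6)], []),
     Split 0 8 (Refer 5 [0,1,2,3,4,5,6,8,7,9]) (Split 0 7 (Refer 5 [0,1,2,3,4,5,6,7,8,9]) (Split
     0 9 (Colouring [0,7,8]) (Split 7 8 (Refer 13 [0,1,2,3,4,5,6,7,8,9]) (Split 8 9 (Refer 13
     [0,1,2,3,4,5,6,8,9,7]) (Colouring [1,2,3,4,5,6])))))),
    (([(0,1), (0,2), (0,3), (0,4), (0,5), (1,9), (2,9), (3,7), (4,9), (7,9), (8,9)], [(0,6),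
    (6,9)]),
     Split 3 6 (Split 6 8 (Colouring [1,2,3,4,5,8]) (Split 5 8 (Split 3 8 (Split 5 7 (Refer 3
     [0,3,5,1,2,4,7,8,9,6]) (Colouring [1,2,3,4,5,7])) (Colouring [1,2,3,4,5,8])) (Colouring
     [1,2,3,4,5,8]))) (Split 5 8 (Split 5 7 (Split 3 8 (Refer 3 [0,3,5,1,2,4,7,8,9,6]) (Split 5 6
     (Colouring [1,2,4,5,7]) (Colouring [1,2,3,4,7,8]))) (Colouring [1,2,4,5,7,8])) (Colouring
     [1,2,4,5,7,8]))),
    (([(0,1), (0,2), (0,3), (0,4), (0,5), (2,6), (2,9), (3,7), (4,9), (5,7), (5,8), (7,9),
    (8,9)], [(1,9), (6,7)]),
     Split 3 8 (Split 4 6 (Split 6 8 (Refer 1 [0,2,4,3,5,9,6,8,7,1]) (Split 5 6 (Split 3 6 (Refer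
     2 [9,2,4,7,8,0,6,3,5,1]) (Refer 1 [9,2,4,7,8,0,6,5,3,1])) (Split 3 6 (Refer 1
     [9,2,4,7,8,0,6,3,5,1]) (Refer 0 [0,3,5,2,4,7,8,9,6,1])))) (Colouring [0,4,6,7,8])) (Split 4
     6 (Split 5 6 (Split 1 6 (Split 1 8 (Split 1 7 (Refer 2 [9,2,4,7,8,0,6,1,5,3]) (Split 3 6
     (Refer 4 [0,6,2,4,5,1,3,8,7,9]) (Colouring [1,2,4,5,7]))) (Colouring [1,2,3,4,5,8])) (Split
     1 7 (Split 1 8 (Refer 1 [9,2,4,7,8,0,6,5,1,3]) (Colouring [1,2,3,4,5,8])) (Colouring
     [2,3,4,5,8]))) (Split 1 8 (Split 1 7 (Split 6 8 (Refer 1 [0,1,5,2,4,8,7,9,6,3]) (Split 1 6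
     (Refer 1 [9,2,4,7,8,0,6,1,5,3]) (Refer 0 [0,1,5,2,4,7,8,9,6,3]))) (Colouring [1,2,3,4,7,8]))
     (Colouring [1,2,3,4,5,8]))) (Colouring [0,4,6,7,8]))),
    (([(0,1), (0,2), (0,3), (0,4), (0,5), (2,9), (3,7), (4,9), (5,7), (7,9), (8,9)], [(0,6),
    (0,8), (1,9)]),
     Split 6 7 (Split 4 6 (Split 1 7 (Refer 15 [0,1,3,2,5,4,8,9,6,7]) (Split 3 8 (Split 2 6
     (Split 5 8 (Split 6 8 (Refer 2 [0,2,4,3,5,6,9,7,8,1]) (Refer 1 [0,2,4,3,5,9,6,7,8,1]))
     (Colouring [1,2,4,5,7,8])) (Colouring [0,4,7,8])) (Colouring [1,2,3,4,7,8]))) (Colouring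
     [0,2,7,8])) (Split 2 6 (Split 5 8 (Refer 16 [0,1,2,3,4,5,6,7,8,9]) (Split 3 8 (Refer 16
     [0,1,2,5,4,3,6,7,8,9]) (Colouring [1,2,3,4,5,8]))) (Colouring [0,2,6,7,8]))),
    (([(0,1), (0,2), (0,3), (0,4), (0,5), (2,9), (3,7), (4,9), (7,9), (8,9)], [(0,6), (0,8)]),
     Split 1 9 (Split 6 9 (Refer 14 [9,1,2,4,6,7,8,0,3,5]) (Refer 15 [0,1,2,3,4,5,6,7,8,9]))
     (Split 5 7 (Refer 17 [0,1,2,3,4,5,6,7,8,9]) (Split 5 9 (Split 6 9 (Refer 14
     [9,2,4,5,6,7,8,0,1,3]) (Refer 15 [0,2,4,3,5,1,6,7,8,9])) (Split 1 7 (Refer 17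
     [0,5,2,1,4,3,6,7,8,9]) (Split 6 9 (Colouring [0,4,6,7,8]) (Split 3 8 (Split 3 6 (Colouring
     [1,2,3,4,5,7]) (Split 5 8 (Refer 17 [0,1,2,3,4,5,6,8,7,9]) (Colouring [1,2,4,5,7,8])))
     (Split 5 8 (Split 5 6 (Colouring [1,2,3,4,5,7]) (Colouring [1,2,3,4,7,8])) (Colouring
     [1,2,3,4,5,7,8])))))))),
    (([(0,1), (0,2), (0,3), (0,4), (0,5), (2,9), (3,7), (7,9), (8,9)], [(0,6), (0,8)]),
     Split 4 9 (Refer 18 [0,1,2,3,4,5,6,7,8,9]) (Split 5 9 (Refer 18 [0,1,2,3,5,4,6,7,8,9])
     (Split 6 9 (Colouring [0,2,6,7,8]) (Split 1 9 (Refer 18 [0,4,1,3,2,5,6,7,8,9]) (Split 6 8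
     (Split 6 7 (Split 4 6 (Split 2 6 (Refer 18 [0,1,2,3,4,5,9,7,8,6]) (Split 5 6 (Refer 18
     [0,1,4,3,5,2,9,7,8,6]) (Colouring [0,4,7,8]))) (Split 1 6 (Split 5 6 (Refer 18
     [0,2,1,3,5,4,9,7,8,6]) (Colouring [0,2,7,8])) (Colouring [0,2,7,8]))) (Colouring [0,6,7,8]))
     (Colouring [0,6,7,8])))))),
    (([(0,1), (0,2), (0,3), (0,4), (0,5), (2,9), (7,9), (8,9)], [(0,6), (0,7)]),
     Split 0 8 (Refer 14 [0,1,2,3,4,5,8,6,7,9]) (Split 3 7 (Refer 19 [0,1,2,3,4,5,6,7,8,9])
     (Split 1 7 (Refer 19 [0,3,2,1,4,5,6,7,8,9]) (Split 4 7 (Refer 19 [0,1,2,4,3,5,6,7,8,9])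
     (Split 3 8 (Refer 19 [0,1,2,3,4,5,6,8,7,9]) (Split 4 8 (Refer 19 [0,1,2,4,3,5,6,8,7,9])
     (Split 5 8 (Refer 19 [0,1,2,5,3,4,6,8,7,9]) (Colouring [1,2,3,4,5,7,8])))))))),
    (([(0,1), (0,2), (0,3), (0,4), (0,5), (7,9)], [(0,6), (0,8), (0,9), (2,7), (6,9), (8,9)]),
     Split 4 7 (Split 7 8 (Refer 20 [0,1,4,2,3,5,6,8,9,7]) (Split 6 7 (Refer 20
     [0,1,4,2,3,5,8,6,9,7]) (Colouring [1,2,3,4,5]))) (Split 1 7 (Split 6 7 (Refer 20
     [0,2,1,3,4,5,8,6,9,7]) (Split 7 8 (Refer 20 [0,2,1,3,4,5,6,8,9,7]) (Colouring [1,2,3,4,5])))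
     (Split 5 7 (Split 6 7 (Refer 20 [0,1,5,2,3,4,8,6,9,7]) (Split 7 8 (Refer 20
     [0,1,5,2,3,4,6,8,9,7]) (Colouring [1,2,3,4,5]))) (Colouring [1,2,3,4,5,7])))),
    (([(0,1), (0,2), (0,3), (0,4), (0,5), (2,9), (7,9)], [(0,6), (0,8), (8,9)]),
     Split 6 9 (Refer 20 [0,1,2,3,4,5,8,6,7,9]) (Refer 21 [0,1,2,3,4,5,6,7,8,9])),
    (([(0,1), (0,2), (0,3), (0,4), (0,5), (2,9), (7,9)], [(0,6), (0,7)]),
     Split 8 9 (Refer 20 [0,1,2,3,4,5,6,7,8,9]) (Split 0 8 (Refer 14 [0,1,2,3,4,5,8,6,7,9])
     (Refer 22 [0,1,2,3,4,5,6,7,8,9]))),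
    (([(0,1), (0,2), (0,3), (0,4), (0,5), (2,9)], [(0,6), (0,7)]),
     Split 7 9 (Refer 23 [0,1,2,3,4,5,6,7,8,9]) (Split 0 8 (Refer 14 [0,1,2,3,4,5,8,6,7,9])
     (Split 6 9 (Refer 23 [0,1,2,3,4,5,7,6,8,9]) (Split 8 9 (Refer 23 [0,1,2,3,4,5,6,8,7,9])
     (Split 6 8 (Split 1 6 (Refer 23 [0,2,1,3,4,5,7,8,9,6]) (Split 7 8 (Split 3 8 (Refer 23
     [0,1,3,2,4,5,7,6,9,8]) (Refer 21 [0,1,3,2,4,5,7,8,9,6])) (Refer 21 [0,2,1,3,4,5,7,6,9,8])))
     (Split 6 7 (Split 4 6 (Refer 23 [0,1,4,2,3,5,8,7,9,6]) (Split 2 6 (Refer 23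
     [0,1,2,3,4,5,8,7,9,6]) (Split 3 6 (Refer 23 [0,1,3,2,4,5,8,7,9,6]) (Split 1 6 (Refer 23
     [0,2,1,3,4,5,8,7,9,6]) (Colouring [1,2,3,4,5,6]))))) (Colouring [1,2,3,4,5]))))))),
    (([(0,1), (0,2), (0,3), (0,4), (0,5)], []),
     Split 0 7 (Refer 14 [0,1,2,3,4,5,7,6,8,9]) (Split 0 6 (Refer 14 [0,1,2,3,4,5,6,7,8,9])
     (Split 2 9 (Refer 24 [0,1,2,3,4,5,6,7,8,9]) (Split 3 8 (Refer 24 [0,1,3,2,4,5,6,7,9,8])
     (Split 4 9 (Refer 24 [0,1,4,2,3,5,6,7,8,9]) (Split 1 9 (Refer 24 [0,2,1,3,4,5,6,7,8,9])
     (Split 3 9 (Refer 24 [0,1,3,2,4,5,6,7,8,9]) (Split 1 8 (Refer 24 [0,2,1,3,4,5,6,7,9,8])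
     (Split 2 8 (Refer 24 [0,1,2,3,4,5,6,7,9,8]) (Split 4 8 (Refer 24 [0,1,4,2,3,5,6,7,9,8])
     (Split 5 9 (Refer 24 [0,1,5,2,3,4,6,7,8,9]) (Split 5 8 (Refer 24 [0,1,5,2,3,4,6,7,9,8])
     (Colouring [0,6,7]))))))))))))),
    (([(0,1), (0,2), (0,3), (0,4), (1,7), (1,8), (1,9), (2,5), (2,6), (2,9), (3,5), (4,7), (5,7),
    (5,8), (6,7)], []),
     Split 3 6 (Split 6 8 (Split 4 8 (Refer 2 [0,1,4,2,3,7,8,5,6,9]) (Split 4 9 (Refer 1
     [2,0,9,5,6,1,4,7,8,3]) (Split 3 9 (Refer 2 [1,0,9,7,8,2,3,5,6,4]) (Colouring [0,1,5,6]))))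
     (Split 4 8 (Refer 1 [0,1,4,2,3,7,8,5,6,9]) (Split 4 9 (Split 3 9 (Refer 2
     [7,1,4,5,6,0,9,2,3,8]) (Refer 1 [7,1,4,5,6,0,9,2,3,8])) (Colouring [1,2,3,7])))) (Split 4 8
     (Split 6 8 (Split 4 9 (Refer 2 [2,0,9,5,6,1,4,7,8,3]) (Split 3 9 (Refer 1
     [1,0,9,7,8,2,3,5,6,4]) (Colouring [0,2,7,8]))) (Split 3 9 (Split 4 9 (Refer 2
     [5,2,3,7,8,0,9,1,4,6]) (Refer 1 [5,2,3,7,8,0,9,1,4,6])) (Colouring [1,2,4,5]))) (Split 6 8
     (Split 4 9 (Refer 1 [2,0,9,5,6,1,4,7,8,3]) (Split 3 9 (Refer 1 [1,0,9,7,8,2,3,5,6,4])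
     (Colouring [0,1,5,6]))) (Colouring [1,2,3,4,6,8])))),
    (([(0,1), (0,2), (0,3), (0,4), (1,7), (1,8), (1,9), (2,5), (2,9), (3,5), (4,7), (5,7), (5,8),
    (6,7)], [(0,6)]),
     Split 6 9 (Split 3 9 (Split 4 9 (Refer 25 [9,1,2,3,4,6,0,5,7,8]) (Split 6 8 (Refer 1
     [5,2,3,7,8,9,0,1,6,4]) (Split 4 8 (Refer 1 [5,2,3,7,8,0,9,1,4,6]) (Colouring [1,2,3,7]))))
     (Colouring [1,2,4,5,6])) (Split 2 6 (Refer 26 [0,1,2,3,4,5,6,7,8,9]) (Split 3 9 (Split 3 6
     (Refer 26 [0,1,3,2,4,5,6,7,8,9]) (Split 6 8 (Refer 0 [1,0,9,7,8,2,3,5,6,4]) (Split 4 8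
     (Split 4 9 (Refer 2 [5,2,3,7,8,0,9,1,4,6]) (Refer 1 [5,2,3,7,8,0,9,1,4,6])) (Colouring
     [1,2,3,4,6,8])))) (Colouring [1,2,4,5,6])))),
    (([(0,1), (0,2), (0,3), (0,4), (1,7), (1,9), (2,5), (3,5), (4,7), (5,7), (5,8), (6,7)],
    [(0,6), (0,8), (5,9)]),
     Split 1 8 (Split 2 6 (Refer 27 [5,7,2,3,8,0,9,1,4,6]) (Split 3 9 (Refer 27
     [0,1,3,2,4,5,6,7,8,9]) (Colouring [1,2,4,5,6]))) (Split 4 9 (Split 2 6 (Split 2 9 (Refer 27
     [0,2,1,4,3,7,8,5,6,9]) (Split 3 6 (Split 6 9 (Refer 1 [0,1,4,2,3,7,9,6,5,8]) (Split 3 9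
     (Refer 27 [0,3,1,4,2,7,8,5,6,9]) (Refer 0 [0,2,3,1,4,5,6,7,9,8]))) (Colouring [1,3,4,5,6])))
     (Split 3 9 (Split 4 8 (Refer 27 [0,4,3,2,1,5,6,7,8,9]) (Split 3 6 (Refer 27
     [0,3,1,4,2,7,8,5,6,9]) (Colouring [1,2,3,4,6,8]))) (Colouring [1,2,4,5,6]))) (Colouring
     [1,2,3,7,8]))),
    (([(0,1), (0,2), (0,3), (0,4), (1,7), (2,5), (3,5), (4,7), (5,7), (5,8), (6,7)], [(0,6),
    (0,8), (0,9), (5,9), (7,9)]),
     Split 1 9 (Refer 28 [0,1,2,3,4,5,6,7,8,9]) (Split 4 8 (Split 4 9 (Refer 28
     [0,4,2,3,1,5,6,7,8,9]) (Split 3 9 (Refer 28 [0,3,1,4,2,7,8,5,6,9]) (Split 3 6 (Split 1 8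
     (Split 2 6 (Split 6 8 (Refer 2 [0,1,4,2,3,7,8,5,6,9]) (Refer 1 [0,1,4,2,3,7,8,5,6,9]))
     (Colouring [1,2,4,5,6])) (Colouring [1,2,3,7,8])) (Colouring [0,2,7,8])))) (Colouring
     [2,3,4,7,8]))),
    (([(0,1), (0,2), (0,3), (0,4), (1,7), (2,5), (3,5), (5,7), (5,8), (6,7)], [(0,6), (0,8),
    (0,9)]),
     Split 4 5 (Refer 25 [5,2,3,4,7,8,0,1,6,9]) (Split 5 9 (Refer 25 [5,2,3,7,8,9,0,1,4,6])
     (Split 7 9 (Split 4 7 (Refer 25 [7,1,4,5,6,9,0,2,3,8]) (Colouring [2,3,4,7,8])) (Split 4 7
     (Refer 29 [0,1,2,3,4,5,6,7,8,9]) (Split 1 8 (Split 1 9 (Refer 29 [5,2,7,8,3,1,4,0,9,6])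
     (Colouring [2,3,4,7,8])) (Colouring [1,2,3,4,7,8])))))),
    (([(0,1), (0,2), (0,3), (0,4), (1,7), (2,5), (5,7), (5,8), (6,7)], [(0,6), (0,8), (0,9)]),
     Split 3 5 (Refer 30 [0,1,2,3,4,5,6,7,8,9]) (Split 4 7 (Refer 30 [0,2,1,4,3,7,8,5,6,9])
     (Split 6 9 (Split 4 6 (Split 3 6 (Refer 30 [0,1,3,4,2,6,5,7,9,8]) (Split 4 5 (Refer 30
     [0,1,2,4,3,5,6,7,8,9]) (Split 2 9 (Colouring [1,2,3,4,5,6]) (Colouring [1,3,4,5,6]))))
     (Split 2 6 (Colouring [1,3,4,5,6]) (Split 4 5 (Refer 30 [0,1,2,4,3,5,6,7,8,9]) (Colouring
     [1,2,3,4,5,6])))) (Split 3 7 (Refer 30 [0,2,1,3,4,7,8,5,6,9]) (Split 1 9 (Split 4 5 (Refer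
     30 [0,1,2,4,3,5,6,7,8,9]) (Split 6 8 (Split 4 8 (Split 3 8 (Refer 30 [0,2,3,4,1,8,7,5,6,9])
     (Split 1 8 (Refer 30 [0,2,1,4,3,8,7,5,6,9]) (Colouring [1,2,3,4,7,8]))) (Split 1 8 (Split 3
     8 (Refer 30 [0,2,1,3,4,8,7,5,6,9]) (Split 4 6 (Split 3 6 (Refer 30 [0,1,3,4,2,6,5,7,8,9])
     (Split 2 6 (Refer 30 [0,1,2,4,3,6,5,7,8,9]) (Colouring [1,2,3,4,5,6]))) (Split 2 9 (Split 2
     6 (Split 3 6 (Refer 30 [0,1,2,3,4,6,5,7,8,9]) (Split 4 9 (Refer 0 [1,7,8,0,9,5,6,2,4,3])
     (Split 3 9 (Refer 0 [1,7,8,0,9,5,6,2,3,4]) (Colouring [0,2,7,8])))) (Colouring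
     [1,2,3,4,5,6])) (Colouring [1,3,4,5,6])))) (Colouring [1,2,3,4,7,8]))) (Colouring
     [1,2,3,4,5]))) (Split 4 8 (Split 3 8 (Split 8 9 (Refer 30 [0,2,3,4,1,8,7,5,9,6]) (Split 6 8
     (Refer 30 [0,2,3,4,1,8,7,5,6,9]) (Split 5 9 (Colouring [1,2,3,4,5]) (Colouring
     [1,2,3,4,7])))) (Colouring [2,3,4,7,8])) (Colouring [2,3,4,7,8]))))))),
    (([(0,1), (0,2), (0,3), (0,4), (1,7), (2,6), (5,7), (6,7)], [(0,5), (0,8), (0,9), (2,5),
    (3,5), (7,8)]),
     Split 6 9 (Refer 31 [0,1,2,3,4,6,5,7,9,8]) (Split 6 8 (Refer 31 [0,1,2,3,4,6,5,7,8,9])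
     (Split 7 9 (Split 4 9 (Split 8 9 (Refer 31 [0,1,4,2,3,9,5,7,8,6]) (Split 3 7 (Refer 25
     [7,1,3,5,6,9,0,2,4,8]) (Colouring [1,2,3,4,7]))) (Split 3 9 (Split 8 9 (Refer 31
     [0,1,3,2,4,9,5,7,8,6]) (Split 4 7 (Refer 25 [7,1,4,5,6,9,0,2,3,8]) (Colouring [1,2,3,4,7])))
     (Colouring [0,6,7,8]))) (Colouring [1,2,3,4,5])))),
    (([(0,1), (0,2), (0,3), (0,4), (1,7), (5,7), (5,8), (6,7)], [(0,5), (0,6), (0,8), (0,9)]),
     Split 2 5 (Refer 31 [0,1,2,3,4,5,6,7,8,9]) (Split 3 5 (Refer 31 [0,1,3,2,4,5,6,7,8,9])
     (Split 2 6 (Refer 32 [0,1,2,3,4,5,6,7,8,9]) (Split 4 5 (Refer 31 [0,1,4,2,3,5,6,7,8,9])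
     (Split 4 6 (Refer 32 [0,1,4,2,3,5,6,7,8,9]) (Split 7 9 (Split 4 9 (Refer 32
     [0,1,4,2,3,5,9,7,8,6]) (Split 3 9 (Refer 32 [0,1,3,2,4,5,9,7,8,6]) (Colouring [0,7,8])))
     (Colouring [1,2,3,4,5,6]))))))),
    (([(0,1), (0,2), (0,3), (0,4), (1,7), (2,7), (2,8), (5,7), (6,7)], [(0,6), (0,9), (5,8),
    (6,8), (6,9)]),
     Split 7 9 (Refer 25 [7,1,2,5,6,9,0,3,4,8]) (Split 3 5 (Split 3 6 (Split 4 5 (Split 2 9
     (Refer 33 [2,0,7,8,9,5,6,3,4,1]) (Split 3 8 (Refer 33 [7,1,2,5,6,3,4,0,8,9]) (Split 5 9
     (Refer 33 [0,1,2,3,4,5,6,7,9,8]) (Split 1 8 (Split 4 6 (Split 4 8 (Refer 33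
     [7,1,2,5,6,4,3,0,8,9]) (Refer 0 [0,3,4,1,2,5,6,7,8,9])) (Colouring [1,2,3,4,6])) (Colouring
     [1,3,4,7,8]))))) (Colouring [1,2,3,4,5])) (Refer 32 [0,1,3,2,4,6,5,7,8,9])) (Colouring
     [1,2,3,4,5]))),
    (([(0,1), (0,2), (0,3), (0,4), (1,7), (5,7), (6,7)], [(0,5), (0,6), (0,8), (0,9)]),
     Split 5 8 (Refer 33 [0,1,2,3,4,5,6,7,8,9]) (Split 6 9 (Refer 33 [0,1,2,3,4,6,5,7,9,8])
     (Split 6 8 (Refer 33 [0,1,2,3,4,6,5,7,8,9]) (Split 2 7 (Split 5 9 (Refer 33
     [0,1,2,3,4,5,6,7,9,8]) (Split 4 7 (Refer 25 [7,1,2,4,5,6,0,3,8,9]) (Split 3 7 (Refer 25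
     [7,1,2,3,5,6,0,4,8,9]) (Split 1 8 (Refer 34 [0,2,1,3,4,6,5,7,8,9]) (Split 1 9 (Refer 34
     [0,2,1,3,4,6,5,7,9,8]) (Colouring [2,3,4,7])))))) (Split 4 7 (Split 1 8 (Refer 34
     [0,4,1,2,3,5,6,7,8,9]) (Split 3 7 (Refer 25 [7,1,3,4,5,6,0,2,8,9]) (Split 5 9 (Refer 33
     [0,1,2,3,4,5,6,7,9,8]) (Split 1 9 (Refer 34 [0,4,1,2,3,6,5,7,9,8]) (Colouring [2,3,4,7])))))
     (Split 5 9 (Refer 33 [0,1,2,3,4,5,6,7,9,8]) (Split 3 7 (Split 3 9 (Refer 34
     [0,1,3,2,4,6,5,7,9,8]) (Split 3 8 (Refer 34 [0,1,3,2,4,6,5,7,8,9]) (Colouring [1,2,4,7])))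
     (Colouring [1,2,3,4,7])))))))),
    (([(0,1), (0,2), (0,3), (0,4), (5,7), (6,7), (6,9)], [(0,5), (0,6), (0,7), (0,8), (0,9),
    (1,7), (2,7), (3,7), (4,7)]),
     Split 4 6 (Refer 35 [0,4,1,2,3,7,9,6,5,8]) (Split 2 6 (Refer 35 [0,2,1,3,4,7,9,6,5,8])
     (Split 1 6 (Refer 35 [0,1,2,3,4,7,9,6,5,8]) (Split 8 9 (Split 3 9 (Refer 35
     [0,3,1,2,4,6,8,9,5,7]) (Split 2 9 (Refer 35 [0,2,1,3,4,6,8,9,5,7]) (Split 1 9 (Refer 35
     [0,1,2,3,4,6,8,9,5,7]) (Colouring [0,5,6,8])))) (Split 3 6 (Refer 35 [0,3,1,2,4,7,9,6,5,8])
     (Split 5 8 (Split 3 5 (Refer 35 [0,3,1,2,4,7,8,5,6,9]) (Split 2 5 (Refer 35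
     [0,2,1,3,4,7,8,5,6,9]) (Split 4 5 (Refer 35 [0,4,1,2,3,7,8,5,6,9]) (Colouring
     [1,2,3,4,5,6])))) (Colouring [1,2,3,4,6,7]))))))),
    (([(0,1), (0,2), (0,3), (0,4), (5,7), (6,7)], [(0,5), (0,6), (0,7), (0,8), (0,9)]),
     Split 1 7 (Refer 35 [0,1,2,3,4,5,6,7,8,9]) (Split 3 7 (Refer 35 [0,3,1,2,4,5,6,7,8,9])
     (Split 4 7 (Refer 35 [0,4,1,2,3,5,6,7,8,9]) (Split 2 7 (Refer 35 [0,2,1,3,4,5,6,7,8,9])
     (Split 6 9 (Refer 36 [0,1,2,3,4,5,6,7,8,9]) (Split 5 8 (Refer 36 [0,1,2,3,4,6,5,7,9,8])
     (Split 5 9 (Refer 36 [0,1,2,3,4,6,5,7,8,9]) (Split 6 8 (Refer 36 [0,1,2,3,4,5,6,7,9,8])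
     (Colouring [1,2,3,4,7]))))))))),
    (([(0,1), (0,2), (0,3), (0,4), (6,7)], [(0,5), (0,6), (0,7), (0,8), (0,9)]),
     Split 5 7 (Refer 37 [0,1,2,3,4,5,6,7,8,9]) (Split 6 8 (Refer 37 [0,1,2,3,4,7,8,6,5,9])
     (Split 6 9 (Refer 37 [0,1,2,3,4,7,9,6,5,8]) (Split 5 6 (Refer 37 [0,1,2,3,4,5,7,6,8,9])
     (Split 7 9 (Refer 37 [0,1,2,3,4,6,9,7,5,8]) (Split 7 8 (Refer 37 [0,1,2,3,4,6,8,7,5,9])
     (Split 8 9 (Split 5 8 (Refer 37 [0,1,2,3,4,5,9,8,6,7]) (Split 5 9 (Refer 37
     [0,1,2,3,4,5,8,9,6,7]) (Colouring [1,2,3,4]))) (Split 5 9 (Split 5 8 (Refer 37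
     [0,1,2,3,4,8,9,5,6,7]) (Colouring [1,2,3,4])) (Colouring [1,2,3,4]))))))))),
    (([(0,1), (0,2), (0,3), (0,4)], []),
     Split 0 7 (Refer 25 [0,1,2,3,4,7,5,6,8,9]) (Split 0 6 (Refer 25 [0,1,2,3,4,6,5,7,8,9])
     (Split 0 5 (Refer 25 [0,1,2,3,4,5,6,7,8,9]) (Split 0 9 (Refer 25 [0,1,2,3,4,9,5,6,7,8])
     (Split 0 8 (Refer 25 [0,1,2,3,4,8,5,6,7,9]) (Split 6 7 (Refer 38 [0,1,2,3,4,5,6,7,8,9])
     (Split 6 8 (Refer 38 [0,1,2,3,4,5,6,8,7,9]) (Split 5 7 (Refer 38 [0,1,2,3,4,6,5,7,8,9])
     (Split 5 8 (Refer 38 [0,1,2,3,4,6,5,8,7,9]) (Split 6 9 (Refer 38 [0,1,2,3,4,5,6,9,7,8])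
     (Split 5 9 (Refer 38 [0,1,2,3,4,6,5,9,7,8]) (Split 8 9 (Refer 38 [0,1,2,3,4,5,8,9,6,7])
     (Split 7 8 (Refer 38 [0,1,2,3,4,5,7,8,6,9]) (Colouring [1,2,3,4]))))))))))))))]"

text \<open>The whole finite case distinction is verified here, by rewriting with the equations of
  the checker.\<close>

lemma check_stars_certificate: "check_all targets stars_certificate"
  by code_simp

theorem theorem3p1:
  fixes G :: "('a, 'b) pre_digraph"
  assumes "graph G"
    and "card (verts G) = 10"
    and "triangle_free G"
    and "\<chi> 1 G = 3"
  shows "digraph_iso G G5 \<or>
    (\<exists>u \<in> verts G. \<exists>H \<in> {G1, G2, G3, G4}. digraph_iso (pre_digraph.del_vert G u) H)"
proof -
  \<comment> \<open>The least positive number of classes that suffices is 3, so 2 classes do not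
    suffice.\<close>
  have "\<not> colourable G 2 1"
    using not_less_Least[of 2 "\<lambda>m. 0 < m \<and> colourable G m 1"] assms(4)
    by (simp add: defective_chromatic_number_def)
  with assms interpret non_two_colourable G
    by (simp add: non_two_colourable_def non_two_colourable_axioms_def)
  \<comment> \<open>The star with four edges is the last entry of the certificate, hence conclusive
    by soundness of the checker.\<close>
  have "([(0, 1), (0, 2), (0, 3), (0, 4)], []) \<in> fst ` set stars_certificate"
    by (simp only: stars_certificate_def list.set image_insert fst_conv insert_iff simp_thms)
  then have "conclusive ([(0, 1), (0, 2), (0, 3), (0, 4)], [])"
    using check_all_sound[OF check_stars_certificate conclusive_targets] by blast
  then show ?thesis
    using settled_if_star_conclusive unfolding settled_def by blast
qed

end
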